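(* Let $A=\{a,b,c\}$, where $a,b,c$ are positive integers with $a<b<c$ and $\gcd(a,b,c)=1$. Suppose that either $A$ contains $1$ and an integer $m$ with $2\le m\le 7$, or $A$ contains both $2$ and $3$. Then $p_A(3)=\{p_a(3),p_b(3),p_c(3)\}$ is a regular sequence in $R_3=\mathbb{C}[x_1,x_2,x_3]$ if and only if $abc\equiv 0 \pmod 6$.
   Context: For $k\ge 1$, $p_k(3)=x_1^k+x_2^k+x_3^k\in R_3=\mathbb{C}[x_1,x_2,x_3]$ is the power sum of degree $k$ in three variables. A set of three homogeneous polynomials (of positive degree) in $R_3$ is a regular sequence if and only if their only common zero in $\mathbb{C}^3$ is $(0,0,0)$. *)

theory Defs
  imports "HOL-Computational_Algebra.Computational_Algebra" "HOL-Number_Theory.Cong"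
begin

text \<open>The ring \<open>R\<^sub>3 = \<complex>[x\<^sub>1, x\<^sub>2, x\<^sub>3]\<close>, represented as the iterated
  polynomial ring \<open>\<complex>[x\<^sub>1][x\<^sub>2][x\<^sub>3]\<close>: the outermost polynomial variable is \<open>x\<^sub>3\<close>.\<close>

type_synonym R3 = "complex poly poly poly"

definition x1 :: R3 where "x1 = [:[:[:0, 1:]:]:]"
definition x2 :: R3 where "x2 = [:[:0, 1:]:]"
definition x3 :: R3 where "x3 = [:0, 1:]"

definition power_sum3 :: "nat \<Rightarrow> R3" where
  "power_sum3 k = x1 ^ k + x2 ^ k + x3 ^ k"

text \<open>The ideal generated by a set is its span in the ring regarded as a module over itself.\<close>

definition ideal_gen :: "'a::comm_ring_1 set \<Rightarrow> 'a set" where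
  "ideal_gen S = module.span (*) S"

text \<open>The usual commutative algebra notion: each \<open>f\<^sub>i\<close> is a non-zero-divisor modulo
  the ideal generated by the preceding elements, and the whole sequence generates a proper ideal.\<close>

definition regular_sequence :: "'a::comm_ring_1 list \<Rightarrow> bool" where
  "regular_sequence fs \<longleftrightarrow>
     (\<forall>i<length fs. \<forall>g. fs ! i * g \<in> ideal_gen (set (take i fs))
                        \<longrightarrow> g \<in> ideal_gen (set (take i fs))) \<and>
     ideal_gen (set fs) \<noteq> UNIV"

end

theory Submission
  imports Defs "HOL-Computational_Algebra.Field_as_Ring"
begin

text \<open>
  If 6 does not divide \<open>abc\<close>, then the three power sums vanish on the line through \<open>(1, -1, 0)\<close> or
  through \<open>(1, \<omega>, \<omega>\<^sup>2)\<close> with \<open>\<omega>\<close> a primitive cube root of unity, hence lie in an ideal generated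
  by two linear forms; a determinant argument excludes this for a regular sequence.

  Conversely, if \<open>a = 1\<close>, one eliminates the third variable, and regularity becomes coprimality of
  two bivariate polynomials, which holds as soon as they have only the trivial common zero.
  By Newton's identities for \<open>e1 = 0\<close>, the power sums of degree 2, 3, 4, 5, 7 are monomials in
  \<open>e2, e3\<close>, which leaves the easy cases \<open>e2 = 0\<close> and \<open>e3 = 0\<close>. In degree 6 the relation
  \<open>3 e3\<^sup>2 = 2 e2\<^sup>3\<close> lets one scale to \<open>e2 = 6\<close>, \<open>e3 = 12\<close>, and the resulting integer sequence of
  power sums is nonzero by 2-adic valuation. If \<open>a = 2\<close> and \<open>b = 3\<close>, then \<open>p\<^sub>n\<close> is congruent to a
  rational multiple of \<open>e1\<^sup>n\<close> modulo \<open>(p\<^sub>2, p\<^sub>3)\<close>, again nonzero by 2-adic valuation, and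
  \<open>e1 = p\<^sub>1\<close> is regular modulo \<open>(p\<^sub>2, p\<^sub>3)\<close> because the regular sequence \<open>p\<^sub>1, p\<^sub>2, p\<^sub>3\<close> can be
  rotated.
\<close>

section \<open>Ideals and regular sequences of length three\<close>

lemma module_mult: "module ((*) :: 'a::comm_ring_1 \<Rightarrow> 'a \<Rightarrow> 'a)"
  by unfold_locales (auto simp: algebra_simps)

lemma ideal_gen_empty [simp]: "ideal_gen {} = {0}"
  by (simp add: ideal_gen_def module.span_empty[OF module_mult])

lemma in_ideal_gen_insert:
  "g \<in> ideal_gen (insert f S) \<longleftrightarrow> (\<exists>u. g - u * f \<in> ideal_gen S)"
  by (simp add: ideal_gen_def module.span_insert[OF module_mult])

lemma ideal_gen_eq_UNIV_iff: "ideal_gen S = UNIV \<longleftrightarrow> 1 \<in> ideal_gen S"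
  unfolding ideal_gen_def
  using module.span_scale[OF module_mult, of 1 S] by (auto simp: UNIV_eq_I)

lemma regular_sequence_triple_iff:
  fixes f g h :: "'a::comm_ring_1"
  shows "regular_sequence [f, g, h] \<longleftrightarrow>
    (\<forall>u. f * u = 0 \<longrightarrow> u = 0) \<and>
    (\<forall>u. f dvd g * u \<longrightarrow> f dvd u) \<and>
    (\<forall>u v w. h * u = v * f + w * g \<longrightarrow> (\<exists>v w. u = v * f + w * g)) \<and>
    (\<forall>u v w. u * f + v * g + w * h \<noteq> 1)"
proof -
  have 1: "u \<in> ideal_gen {f} \<longleftrightarrow> f dvd u" for u
    by (auto simp: in_ideal_gen_insert dvd_def mult.commute)
  have 2: "u \<in> ideal_gen {f, g} \<longleftrightarrow> (\<exists>v w. u = v * f + w * g)" for u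
    by (auto simp: in_ideal_gen_insert algebra_simps)
  have 3: "u \<in> ideal_gen {f, g, h} \<longleftrightarrow> (\<exists>v w z. u = v * f + w * g + z * h)" for u
    by (auto simp: in_ideal_gen_insert algebra_simps)
  have less3: "(\<forall>i<3. P i) \<longleftrightarrow> P 0 \<and> P 1 \<and> P 2" for P :: "nat \<Rightarrow> bool"
    by (auto simp: less_Suc_eq numeral_3_eq_3 numeral_2_eq_2)
  have take: "take 0 [f, g, h] = []" "take 1 [f, g, h] = [f]" "take 2 [f, g, h] = [f, g]"
    by simp_all
  have "regular_sequence [f, g, h] \<longleftrightarrow>
    (\<forall>u. f * u \<in> ideal_gen {} \<longrightarrow> u \<in> ideal_gen {}) \<and>
    (\<forall>u. g * u \<in> ideal_gen {f} \<longrightarrow> u \<in> ideal_gen {f}) \<and>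
    (\<forall>u. h * u \<in> ideal_gen {f, g} \<longrightarrow> u \<in> ideal_gen {f, g}) \<and>
    1 \<notin> ideal_gen {f, g, h}"
    unfolding regular_sequence_def ideal_gen_eq_UNIV_iff length_Cons list.size One_nat_def[symmetric]
    by (simp add: less3 take del: take_Cons_numeral One_nat_def flip: numeral_3_eq_3)
  moreover have "1 \<notin> ideal_gen {f, g, h} \<longleftrightarrow> (\<forall>u v w. u * f + v * g + w * h \<noteq> 1)"
    unfolding 3 by (metis (no_types))
  ultimately show ?thesis
    by (simp only: 1 2 ideal_gen_empty singleton_iff imp_ex)
qed

text \<open>A relation \<open>f * u = v * g + w * h\<close> puts \<open>h * w\<close> into
  \<open>(f, g)\<close>, so \<open>w = w1 * f + w2 * g\<close>. Substitution turns
  \<open>f * (u - w1 * h)\<close> into a multiple of \<open>g\<close> whose cofactor is divisible by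
  \<open>f\<close>, since \<open>g\<close> is regular modulo \<open>f\<close>. Cancelling
  \<open>f\<close> puts \<open>u\<close> into \<open>(g, h)\<close>.\<close>

lemma regular_sequence_rotate:
  fixes f g h :: "'a::idom"
  assumes "regular_sequence [f, g, h]"
    and "g \<noteq> 0" and coprime: "\<And>u. g dvd h * u \<Longrightarrow> g dvd u"
  shows "regular_sequence [g, h, f]"
proof -
  have f: "f * u = 0 \<Longrightarrow> u = 0" and g: "f dvd g * u \<Longrightarrow> f dvd u"
    and h: "h * u = v * f + w * g \<Longrightarrow> \<exists>v w. u = v * f + w * g"
    and proper: "u * f + v * g + w * h \<noteq> 1" for u v w
    using assms(1) unfolding regular_sequence_triple_iff by blast+
  have "\<exists>v w. u = v * g + w * h" if eq: "f * u = v * g + w * h" for u v w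
  proof -
    have "h * w = u * f + (- v) * g" using eq by (simp add: algebra_simps)
    then obtain w1 w2 where w: "w = w1 * f + w2 * g" using h by blast
    have *: "f * (u - w1 * h) = g * (v + w2 * h)" using eq w by (simp add: algebra_simps)
    then have "f dvd v + w2 * h" using g by (metis dvd_triv_left)
    then obtain z where "v + w2 * h = f * z" ..
    with * have "f * (u - w1 * h - g * z) = 0" by (simp add: right_diff_distrib)
    then have "u - w1 * h - g * z = 0" by (rule f)
    then have "u = z * g + w1 * h" by (simp add: mult.commute diff_eq_eq)
    then show ?thesis by blast
  qed
  moreover have "u * g + v * h + w * f \<noteq> 1" for u v w
    using proper[of w u v] by (simp add: algebra_simps)
  moreover have "u = 0" if "g * u = 0" for u
    using that assms(2) by simp
  ultimately show ?thesis
    unfolding regular_sequence_triple_iff using coprime by blast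
qed

section \<open>Necessity: common zeros outside the origin\<close>

text \<open>The determinant \<open>d = u1 v2 - u2 v1\<close> multiplies \<open>y\<close> and \<open>z\<close>, hence \<open>h\<close>, into \<open>(f, g)\<close>.
  Regularity puts \<open>d\<close> itself into \<open>(f, g)\<close>, and comparing coefficients yields \<open>1 \<in> (y, z)\<close>.\<close>

lemma not_regular_sequence_if_codim_2:
  fixes y z :: "'a::idom"
  assumes f: "f = u1 * y + v1 * z" and g: "g = u2 * y + v2 * z" and h: "h = u3 * y + v3 * z"
    and proper: "\<And>p q. p * y + q * z \<noteq> 1"
  shows "\<not> regular_sequence [f, g, h]"
proof
  assume "regular_sequence [f, g, h]"
  then have f_reg: "f * u = 0 \<Longrightarrow> u = 0" and g_reg: "f dvd g * u \<Longrightarrow> f dvd u"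
    and h_reg: "h * u = v * f + w * g \<Longrightarrow> \<exists>v w. u = v * f + w * g" for u v w
    unfolding regular_sequence_triple_iff by blast+
  have "f \<noteq> 0" using f_reg[of 1] by auto
  define d where "d = u1 * v2 - u2 * v1"
  have dy: "d * y = v2 * f - v1 * g" and dz: "d * z = u1 * g - u2 * f"
    by (simp_all add: d_def f g algebra_simps)
  have "h * d = u3 * (d * y) + v3 * (d * z)" by (simp add: h algebra_simps)
  also have "\<dots> = (u3 * v2 - v3 * u2) * f + (v3 * u1 - u3 * v1) * g"
    unfolding dy dz by (simp add: algebra_simps)
  finally obtain \<alpha> \<beta> where d: "d = \<alpha> * f + \<beta> * g" using h_reg by blast
  have "g * (\<beta> * y + v1) = f * (v2 - \<alpha> * y)"
    using dy unfolding d by (simp add: algebra_simps)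
  then obtain \<gamma> where \<gamma>: "\<beta> * y + v1 = f * \<gamma>" using g_reg by (metis dvd_def)
  have "g * (u1 - \<beta> * z) = f * (\<alpha> * z + u2)"
    using dz unfolding d by (simp add: algebra_simps)
  then obtain \<delta> where \<delta>: "u1 - \<beta> * z = f * \<delta>" using g_reg by (metis dvd_def)
  have "f * 1 = (u1 - \<beta> * z) * y + (\<beta> * y + v1) * z" by (simp add: f algebra_simps)
  also have "\<dots> = f * (\<delta> * y + \<gamma> * z)" unfolding \<gamma> \<delta> by (simp add: algebra_simps)
  finally have "\<delta> * y + \<gamma> * z = 1" using \<open>f \<noteq> 0\<close> by (metis mult_left_cancel)
  then show False using proper by blast
qed

text \<open>The two linear forms cut out the line through \<open>(1, s, t)\<close>. Modulo them the
  power sum becomes \<open>(1 + s ^ k + t ^ k) * x1 ^ k\<close>, which is zero.\<close>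

lemma power_sum3_in_line_ideal:
  assumes "1 + s ^ k + t ^ k = (0 :: complex)"
  obtains u v where
    "power_sum3 k = u * (x2 - [:[:[:s:]:]:] * x1) + v * (x3 - [:[:[:t:]:]:] * x1)"
proof -
  let ?s = "[:[:[:s:]:]:] :: R3" and ?t = "[:[:[:t:]:]:] :: R3"
  have c: "[:[:[:a:]:]:] ^ k = ([:[:[:a ^ k:]:]:] :: R3)" for a
    by (simp add: poly_const_pow)
  have "1 + ?s ^ k + ?t ^ k = [:[:[:1 + s ^ k + t ^ k:]:]:]"
    by (simp add: c one_pCons)
  then have 0: "1 + ?s ^ k + ?t ^ k = 0" by (simp add: assms)
  have "power_sum3 k = (x2 ^ k - (?s * x1) ^ k) + (x3 ^ k - (?t * x1) ^ k) + (1 + ?s ^ k + ?t ^ k) * x1 ^ k"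
    unfolding power_sum3_def by (simp add: algebra_simps power_mult_distrib del: mult_pCons_left mult_pCons_right)
  moreover obtain u where "x2 ^ k - (?s * x1) ^ k = (x2 - ?s * x1) * u"
    by (rule that, rule power_diff_sumr2)
  moreover obtain v where "x3 ^ k - (?t * x1) ^ k = (x3 - ?t * x1) * v"
    by (rule that, rule power_diff_sumr2)
  ultimately show ?thesis using 0 that[of u v] by (simp add: mult.commute)
qed

lemma not_regular_sequence_if_common_zero:
  assumes "\<And>k. k \<in> {a, b, c} \<Longrightarrow> 1 + s ^ k + t ^ k = (0 :: complex)"
  shows "\<not> regular_sequence [power_sum3 a, power_sum3 b, power_sum3 c]"
proof -
  let ?y = "x2 - [:[:[:s:]:]:] * x1" and ?z = "x3 - [:[:[:t:]:]:] * x1"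
  have "p * ?y + q * ?z \<noteq> 1" for p q
  proof
    assume "p * ?y + q * ?z = 1"
    \<comment> \<open>Both linear forms vanish at the origin, so 1 is not in their ideal.\<close>
    then have "poly (poly (poly (p * ?y + q * ?z) 0) 0) 0 = 1" by simp
    then show False by (simp add: x1_def x2_def x3_def)
  qed
  moreover obtain u1 v1 where "power_sum3 a = u1 * ?y + v1 * ?z"
    using power_sum3_in_line_ideal assms by blast
  moreover obtain u2 v2 where "power_sum3 b = u2 * ?y + v2 * ?z"
    using power_sum3_in_line_ideal assms by blast
  moreover obtain u3 v3 where "power_sum3 c = u3 * ?y + v3 * ?z"
    using power_sum3_in_line_ideal assms by blast
  ultimately show ?thesis by (rule not_regular_sequence_if_codim_2[rotated 3])
qed

lemma not_regular_sequence_if_not_dvd_6: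
  assumes "\<not> 6 dvd a * b * c" and "0 < a" "0 < b" "0 < c"
  shows "\<not> regular_sequence [power_sum3 a, power_sum3 b, power_sum3 c]"
proof -
  have "\<not> 2 dvd a * b * c \<or> \<not> 3 dvd a * b * c"
    using assms(1) by presburger
  then show ?thesis
  proof
    assume "\<not> 2 dvd a * b * c"
    then show ?thesis
      using assms(2-)
      \<comment> \<open>All three exponents are odd, and being positive they also give
        \<open>0 ^ k = 0\<close>.\<close>
      by (intro not_regular_sequence_if_common_zero[where s = "-1" and t = 0]) auto
  next
    assume *: "\<not> 3 dvd a * b * c"
    define \<omega> :: complex where "\<omega> = Complex (-1/2) (sqrt 3 / 2)"
    have q: "1 + \<omega> + \<omega>\<^sup>2 = 0"
      by (simp add: \<omega>_def power2_eq_square complex_eq_iff)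
    have "\<omega> ^ 3 - 1 = (\<omega> - 1) * (1 + \<omega> + \<omega>\<^sup>2)"
      by (simp add: algebra_simps power2_eq_square power3_eq_cube)
    then have \<omega>3: "\<omega> ^ 3 = 1" using q by simp
    \<comment> \<open>Exponents of \<open>\<omega>\<close> matter only modulo 3; for
      \<open>k\<close> congruent to 1 or 2 the summands are 1, \<open>\<omega>\<close>,
      \<open>\<omega>\<^sup>2\<close> in some order.\<close>
    have "1 + \<omega> ^ k + (\<omega>\<^sup>2) ^ k = 0" if "\<not> 3 dvd k" for k
    proof -
      have p: "\<omega> ^ (3 * m + r) = \<omega> ^ r" for m r
        by (simp add: power_add power_mult \<omega>3)
      have "\<exists>m. k = 3 * m + 1 \<or> k = 3 * m + 2"
        using that by presburger
      then obtain m where "k = 3 * m + 1 \<or> k = 3 * m + 2" ..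
      then show ?thesis
      proof
        assume k: "k = 3 * m + 1"
        then have "2 * k = 3 * (2 * m) + 2" by simp
        then have "\<omega> ^ (2 * k) = \<omega> ^ (3 * (2 * m) + 2)" by (rule arg_cong)
        also have "\<dots> = \<omega>\<^sup>2" by (rule p)
        finally have "(\<omega>\<^sup>2) ^ k = \<omega>\<^sup>2" by (simp flip: power_mult)
        moreover have "\<omega> ^ k = \<omega>" using p[of m 1] by (simp only: k power_one_right)
        ultimately show ?thesis using q by (simp only:)
      next
        assume k: "k = 3 * m + 2"
        then have "2 * k = 3 * (2 * m + 1) + 1" by simp
        then have "\<omega> ^ (2 * k) = \<omega> ^ (3 * (2 * m + 1) + 1)" by (rule arg_cong)
        also have "\<dots> = \<omega>" using p[of _ 1] by (simp only: power_one_right)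
        finally have "(\<omega>\<^sup>2) ^ k = \<omega>" by (simp flip: power_mult)
        moreover have "\<omega> ^ k = \<omega>\<^sup>2" using p[of m 2] by (simp only: k)
        ultimately show ?thesis using q by (simp add: add_ac)
      qed
    qed
    moreover have "\<not> 3 dvd a" "\<not> 3 dvd b" "\<not> 3 dvd c"
      using * by auto
    ultimately show ?thesis
      by (intro not_regular_sequence_if_common_zero[where s = \<omega> and t = "\<omega>\<^sup>2"]) auto
  qed
qed

section \<open>Coprimality in two variables and sequences starting with
  \<open>power_sum3 1\<close>\<close>

lemma poly_map_poly_eval:
  fixes p :: "'a::comm_ring_1 poly poly"
  shows "poly (map_poly (\<lambda>q. poly q r) p) s = poly (poly p [:s:]) r"
  by (induction p) (simp_all add: map_poly_pCons)

text \<open>A nonconstant common divisor \<open>h\<close> would vanish away from the origin. If it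
  has positive degree in the outer variable, fix a suitable \<open>r \<noteq> 0\<close> and solve
  for \<open>s\<close>; otherwise any root \<open>r\<close> of it can be paired with
  \<open>s = 1\<close>.\<close>

lemma coprime_if_no_common_zero:
  fixes f g :: "complex poly poly"
  assumes "\<And>r s. poly (poly f [:s:]) r = 0 \<Longrightarrow> poly (poly g [:s:]) r = 0 \<Longrightarrow> r = 0 \<and> s = 0"
    and "f \<noteq> 0"
  shows "coprime f g"
proof (rule coprimeI)
  fix h assume h: "h dvd f" "h dvd g"
  have no_zero: "r = 0 \<and> s = 0" if "poly (poly h [:s:]) r = 0" for r s
    using that h assms(1)[of s r] by (auto simp: dvd_def)
  have "h \<noteq> 0" using h(1) assms(2) by auto
  have "degree h = 0"
  proof (rule ccontr)
    assume deg: "degree h \<noteq> 0"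
    define l where "l = lead_coeff h"
    \<comment> \<open>The factor \<open>[:0, 1:]\<close> makes \<open>r\<close> nonzero, and
      \<open>l\<close> keeps the leading coefficient alive at \<open>r\<close>.\<close>
    have "[:0, 1:] * l \<noteq> 0" using \<open>h \<noteq> 0\<close> by (simp add: l_def)
    then obtain r where r: "poly ([:0, 1:] * l) r \<noteq> 0" using poly_all_0_iff_0 by blast
    define q where "q = map_poly (\<lambda>p. poly p r) h"
    have "coeff q (degree h) \<noteq> 0" using r by (simp add: q_def coeff_map_poly l_def)
    then have "degree q \<noteq> 0" using deg le_degree by fastforce
    then obtain s where "poly q s = 0"
      using fundamental_theorem_of_algebra[of q] by (auto simp: constant_degree)
    then have "poly (poly h [:s:]) r = 0" by (simp add: q_def poly_map_poly_eval)
    then have "r = 0" using no_zero by blast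
    then show False using r by simp
  qed
  then obtain h0 where h0: "h = [:h0:]" by (metis degree_eq_zeroE)
  have "degree h0 = 0"
  proof (rule ccontr)
    assume "degree h0 \<noteq> 0"
    then obtain r where "poly h0 r = 0"
      using fundamental_theorem_of_algebra[of h0] by (auto simp: constant_degree)
    then show False using no_zero[where r = r and s = 1] h0 by auto
  qed
  then show "is_unit h" using h0 \<open>h \<noteq> 0\<close> by (metis is_unit_const_poly_iff is_unit_iff_degree pCons_0_0)
qed

lemma poly_power_sum3:
  "poly (poly (poly (power_sum3 k) w) v) u = u ^ k + poly v u ^ k + poly (poly w v) u ^ k"
  by (simp add: power_sum3_def x1_def x2_def x3_def)

lemma power_sum3_ideal_proper:
  assumes "0 < a" "0 < b" "0 < c"
  shows "u * power_sum3 a + v * power_sum3 b + w * power_sum3 c \<noteq> 1"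
proof
  assume "u * power_sum3 a + v * power_sum3 b + w * power_sum3 c = 1"
  then have "poly (poly (poly (u * power_sum3 a + v * power_sum3 b + w * power_sum3 c) 0) 0) 0 = 1"
    by simp
  then show False using assms by (simp add: poly_power_sum3 zero_power)
qed

text \<open>\<open>power_sum3 1\<close> is monic and linear in \<open>x3\<close>, so dividing by it
  amounts to substituting \<open>\<xi>\<close>, that is \<open>- x1 - x2\<close>, for
  \<open>x3\<close>. In the resulting bivariate ring, where coprime factors cancel in divisibility,
  it suffices that the images are coprime and the first is nonzero.\<close>

lemma regular_sequence_1_if_no_common_zero:
  assumes "1 < b" "1 < c"
    and no_zero: "\<And>r s t :: complex. r + s + t = 0 \<Longrightarrow> r ^ b + s ^ b + t ^ b = 0 \<Longrightarrow>
      r ^ c + s ^ c + t ^ c = 0 \<Longrightarrow> r = 0 \<and> s = 0"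
  shows "regular_sequence [power_sum3 1, power_sum3 b, power_sum3 c]"
proof -
  define \<xi> :: "complex poly poly" where "\<xi> = - ([:[:0, 1:]:] + [:0, 1:])"
  have eval: "poly (poly (poly (power_sum3 k) \<xi>) [:s:]) r = r ^ k + s ^ k + (- s - r) ^ k" for k r s
    by (simp add: poly_power_sum3 \<xi>_def)
  have p1: "power_sum3 1 = [:- \<xi>, 1:]"
    by (simp add: power_sum3_def x1_def x2_def x3_def \<xi>_def)
  have dvd_iff: "power_sum3 1 dvd f \<longleftrightarrow> poly f \<xi> = 0" for f
    by (simp only: p1 poly_eq_0_iff_dvd)
  let ?F = "\<lambda>k. poly (power_sum3 k) \<xi>"
  have nz: "?F b \<noteq> 0"
  proof
    assume "?F b = 0"
    \<comment> \<open>Evaluation at the point \<open>(1, 1, -2)\<close>; comparing norms contradicts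
      \<open>1 < b\<close>.\<close>
    then have "(- 2) ^ b = (- 2 :: complex)" using eval[of b 1 1] by (simp add: eq_neg_iff_add_eq_0 add.commute)
    then have "norm ((- 2 :: complex) ^ b) = 2" by simp
    then have "(2 :: real) ^ b = 2 ^ 1" by (simp add: norm_power)
    then show False using assms(1) by (subst (asm) power_inject_exp) auto
  qed
  have "coprime (?F b) (?F c)"
    by (rule coprime_if_no_common_zero[OF _ nz], unfold eval, rule no_zero) auto
  then have cop: "?F b dvd ?F c * v \<Longrightarrow> ?F b dvd v" for v
    by (simp add: coprime_dvd_mult_right_iff)
  have "\<exists>v w. u = v * power_sum3 1 + w * power_sum3 b"
    if "power_sum3 c * u = v * power_sum3 1 + w * power_sum3 b" for u v w
  proof -
    have "poly (power_sum3 c * u) \<xi> = poly (v * power_sum3 1 + w * power_sum3 b) \<xi>"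
      using that by simp
    then have "?F c * poly u \<xi> = poly w \<xi> * ?F b"
      using dvd_iff[of "power_sum3 1"] by simp
    then have "?F b dvd poly u \<xi>" using cop by (metis dvd_triv_right)
    then obtain z where "poly u \<xi> = ?F b * z" ..
    then have "power_sum3 1 dvd u - [:z:] * power_sum3 b" unfolding dvd_iff by simp
    then show ?thesis by (metis add_diff_cancel_right' diff_add_cancel dvdE mult.commute)
  qed
  moreover have "power_sum3 1 dvd u" if "power_sum3 1 dvd power_sum3 b * u" for u
    using that nz unfolding dvd_iff by simp
  moreover have "power_sum3 1 \<noteq> 0" unfolding p1 by simp
  then have "u = 0" if "power_sum3 1 * u = 0" for u
    using that by (metis mult_eq_0_iff)
  moreover have "u * power_sum3 1 + v * power_sum3 b + w * power_sum3 c \<noteq> 1" for u v w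
    by (rule power_sum3_ideal_proper) (use assms(1,2) in auto)
  ultimately show ?thesis
    unfolding regular_sequence_triple_iff by blast
qed

section \<open>Newton's identities\<close>

text \<open>The power sum of three quantities in terms of their elementary symmetric functions. The
  ring is left general because integers, complex numbers and \<open>R3\<close> all occur.\<close>

fun newton3 :: "'a::comm_ring_1 \<Rightarrow> 'a \<Rightarrow> 'a \<Rightarrow> nat \<Rightarrow> 'a" where
  "newton3 e1 e2 e3 0 = 3"
| "newton3 e1 e2 e3 (Suc 0) = e1"
| "newton3 e1 e2 e3 (Suc (Suc 0)) = e1 ^ 2 - 2 * e2"
| "newton3 e1 e2 e3 (Suc (Suc (Suc n))) =
     e1 * newton3 e1 e2 e3 (Suc (Suc n)) - e2 * newton3 e1 e2 e3 (Suc n) + e3 * newton3 e1 e2 e3 n"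

lemma newton3_power_sum:
  "x ^ n + y ^ n + z ^ n = newton3 (x + y + z) (x * y + y * z + z * x) (x * y * z) n"
proof (induction "x + y + z" "x * y + y * z + z * x" "x * y * z" n rule: newton3.induct)
  case (4 n)
  show ?case
    unfolding newton3.simps 4[symmetric] by (simp add: algebra_simps)
qed (simp_all add: algebra_simps power2_eq_square)

lemma newton3_scale: "newton3 (t * a) (t ^ 2 * b) (t ^ 3 * c) n = t ^ n * newton3 a b c n"
  by (induction a b c n rule: newton3.induct)
    (simp_all add: algebra_simps power2_eq_square power3_eq_cube)

lemma of_int_newton3: "of_int (newton3 a b c n) = newton3 (of_int a) (of_int b) (of_int c) n"
  by (induction a b c n rule: newton3.induct) simp_all

text \<open>\<open>newton3\<close> is polynomial in its arguments, so it respects congruence modulo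
  an ideal \<open>I\<close>; the recursion step telescopes the difference of the products.\<close>

lemma newton3_cong:
  assumes add: "\<And>x y. x \<in> I \<Longrightarrow> y \<in> I \<Longrightarrow> x + y \<in> I"
    and scale: "\<And>x u. x \<in> I \<Longrightarrow> u * x \<in> I"
    and "b - b' \<in> I" "c - c' \<in> I"
  shows "newton3 a b c n - newton3 a b' c' n \<in> I"
  using assms(3,4)
proof (induction a b c n rule: newton3.induct)
  case (1 a b c)
  \<comment> \<open>Scaling a member of \<open>I\<close> by 0 gives
    \<open>0 \<in> I\<close>.\<close>
  then show ?case using scale[of _ 0] by simp
next
  case (2 a b c)
  then show ?case using scale[of _ 0] by simp
next
  case (3 a b c)
  then show ?case using scale[of "b - b'" "-2"] by (simp add: algebra_simps)
next
  case (4 a b c n)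
  have "newton3 a b c (Suc (Suc (Suc n))) - newton3 a b' c' (Suc (Suc (Suc n))) =
    a * (newton3 a b c (Suc (Suc n)) - newton3 a b' c' (Suc (Suc n)))
    + (- b) * (newton3 a b c (Suc n) - newton3 a b' c' (Suc n))
    + (- newton3 a b' c' (Suc n)) * (b - b')
    + c * (newton3 a b c n - newton3 a b' c' n) + newton3 a b' c' n * (c - c')"
    by (simp add: algebra_simps)
  also have "\<dots> \<in> I"
    by (intro add scale 4)
  finally show ?case .
qed

section \<open>Two integer sequences without zeros, by 2-adic valuation\<close>

text \<open>After division by the indicated powers of 2, the values at consecutive even, odd, even indices
  run modulo 16 through a cycle of length 4 that starts only at index 8; the value at index 6 is 0.\<close>

lemma newton3_0_6_12_even_odd:
  "\<exists>e f g. newton3 0 6 12 (2 * (m + 4)) = (2 ^ (m + 4) * e :: int) \<and>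
     newton3 0 6 12 (2 * (m + 4) + 1) = (2 ^ (m + 4) * f :: int) \<and>
     newton3 0 6 12 (2 * (m + 5)) = (2 ^ (m + 5) * g :: int) \<and>
     (e mod 16, f mod 16, g mod 16) \<in> {(2, 2, 8), (8, 6, 14), (14, 14, 8), (8, 10, 2)}"
proof (induction m)
  case 0
  show ?case
    \<comment> \<open>The values at 8, 9, 10 are -4320, -18144, 62208; divide by 16, 16, 32.\<close>
    by (rule exI[of _ "-270"], rule exI[of _ "-1134"], rule exI[of _ 1944], simp add: eval_nat_numeral)
next
  case (Suc m)
  let ?L = "newton3 0 6 12 :: nat \<Rightarrow> int"
  from Suc.IH obtain e f g where IH: "?L (2 * (m + 4)) = 2 ^ (m + 4) * e"
    "?L (2 * (m + 4) + 1) = 2 ^ (m + 4) * f" "?L (2 * (m + 5)) = 2 ^ (m + 5) * g"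
    and mod: "(e mod 16, f mod 16, g mod 16) \<in> {(2, 2, 8), (8, 6, 14), (14, 14, 8), (8, 10, 2)}"
    by blast
  have rec: "?L (k + 3) = 12 * ?L k - 6 * ?L (k + 1)" for k
    by (simp add: numeral_3_eq_3)
  have suc: "Suc m + 4 = m + 5" "Suc m + 5 = m + 6" by simp_all
  have idx: "2 * (m + 4) + 3 = 2 * (m + 5) + 1" "2 * (m + 4) + 1 + 3 = 2 * (m + 6)"
    "2 * (m + 4) + 1 + 1 = 2 * (m + 5)" by simp_all
  \<comment> \<open>The recursion coefficients 12 and 6 supply the additional powers of 2.\<close>
  have "?L (2 * (m + 5) + 1) = 2 ^ (m + 5) * (6 * e - 3 * f)"
    using rec[of "2 * (m + 4)"] unfolding idx IH by (simp add: power_add algebra_simps)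
  moreover have "?L (2 * (m + 6)) = 2 ^ (m + 6) * (3 * f - 3 * g)"
    using rec[of "2 * (m + 4) + 1"] unfolding idx IH by (simp add: power_add algebra_simps)
  moreover have "(g mod 16, (6 * e - 3 * f) mod 16, (3 * f - 3 * g) mod 16)
      \<in> {(2, 2, 8), (8, 6, 14), (14, 14, 8), (8, 10, 2)}"
  proof -
    have *: "(6 * e - 3 * f) mod 16 = (6 * (e mod 16) - 3 * (f mod 16)) mod 16"
      "(3 * f - 3 * g) mod 16 = (3 * (f mod 16) - 3 * (g mod 16)) mod 16"
      by (rule mod_diff_cong; rule mod_mult_cong; simp)+
    \<comment> \<open>Each listed triple is sent to the next one, and the last to the first.\<close>
    show ?thesis
      using mod unfolding * insert_iff prod.inject empty_iff by (elim disjE conjE) simp_all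
  qed
  ultimately show ?case
    unfolding suc using IH(3)
    by - (rule exI[of _ g], rule exI[of _ "6 * e - 3 * f"], rule exI[of _ "3 * f - 3 * g"], intro conjI)
qed

lemma newton3_0_6_12_nonzero:
  assumes "1 < n" "n \<noteq> 6"
  shows "newton3 0 6 12 n \<noteq> (0 :: int)"
proof (cases "n < 8")
  case True
  then have "n \<in> {2, 3, 4, 5, 7}" using assms by auto
  then show ?thesis by (auto simp: eval_nat_numeral)
next
  case False
  then have "\<exists>m. n = 2 * (m + 4) \<or> n = 2 * (m + 4) + 1" by presburger
  then obtain m where n: "n = 2 * (m + 4) \<or> n = 2 * (m + 4) + 1" ..
  obtain e f where L: "newton3 0 6 12 (2 * (m + 4)) = (2 ^ (m + 4) * e :: int)"
    "newton3 0 6 12 (2 * (m + 4) + 1) = (2 ^ (m + 4) * f :: int)"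
    and "e mod 16 \<noteq> 0" "f mod 16 \<noteq> 0"
    using newton3_0_6_12_even_odd[of m] by force
  then have "e \<noteq> 0" "f \<noteq> 0" by auto
  then show ?thesis using n L by (metis mult_eq_0_iff power_eq_0_iff zero_neq_numeral)
qed

text \<open>The scheme is the same, but the residues are now constant. The start is index 4 because
  the values at 2 and 3 are 0.\<close>

lemma newton3_6_18_36_even_odd:
  "\<exists>e f g. newton3 6 18 36 (2 * (m + 2)) = (2 ^ (m + 2) * e :: int) \<and>
     newton3 6 18 36 (2 * (m + 2) + 1) = (2 ^ (m + 2) * f :: int) \<and>
     newton3 6 18 36 (2 * (m + 3)) = (2 ^ (m + 3) * g :: int) \<and>
     e mod 4 = 2 \<and> f mod 8 = 4 \<and> g mod 4 = 2"
proof (induction m)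
  case 0
  show ?case
    by (rule exI[of _ 54], rule exI[of _ 324], rule exI[of _ 486], simp add: eval_nat_numeral)
next
  case (Suc m)
  let ?L = "newton3 6 18 36 :: nat \<Rightarrow> int"
  from Suc.IH obtain e f g where IH: "?L (2 * (m + 2)) = 2 ^ (m + 2) * e"
    "?L (2 * (m + 2) + 1) = 2 ^ (m + 2) * f" "?L (2 * (m + 3)) = 2 ^ (m + 3) * g"
    and mod: "e mod 4 = 2" "f mod 8 = 4" "g mod 4 = 2"
    by blast
  define f' where "f' = 6 * g - 9 * f + 18 * e"
  define g' where "g' = 3 * f' - 9 * g + 9 * f"
  have rec: "?L (k + 3) = 6 * ?L (k + 2) - 18 * ?L (k + 1) + 36 * ?L k" for k
    by (simp add: numeral_3_eq_3)
  have suc: "Suc m + 2 = m + 3" "Suc m + 3 = m + 4" by simp_all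
  have idx: "2 * (m + 2) + 3 = 2 * (m + 3) + 1" "2 * (m + 2) + 2 = 2 * (m + 3)"
    "2 * (m + 2) + 1 + 3 = 2 * (m + 4)" "2 * (m + 2) + 1 + 2 = 2 * (m + 3) + 1"
    "2 * (m + 2) + 1 + 1 = 2 * (m + 3)" by simp_all
  have f': "?L (2 * (m + 3) + 1) = 2 ^ (m + 3) * f'"
    using rec[of "2 * (m + 2)"] unfolding idx IH f'_def by (simp add: power_add algebra_simps)
  moreover have "?L (2 * (m + 4)) = 2 ^ (m + 4) * g'"
    using rec[of "2 * (m + 2) + 1"] unfolding idx IH f' g'_def by (simp add: power_add algebra_simps)
  moreover have "f' mod 8 = 4 \<and> g' mod 4 = 2"
  proof -
    have "e = 4 * (e div 4) + 2" "f = 8 * (f div 8) + 4" "g = 4 * (g div 4) + 2"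
      using mod by (metis mult_div_mod_eq)+
    then obtain i j k where "e = 4 * i + 2" "f = 8 * j + 4" "g = 4 * k + 2" by blast
    then have "f' = 4 + 8 * (3 * k - 9 * j + 9 * i + 1)"
      "g' = 2 + 4 * (18 * k - 54 * j + 54 * i - 9 * k + 18 * j + 13)"
      unfolding f'_def g'_def by simp_all
    then show ?thesis by (simp only: mod_mult_self2) simp
  qed
  ultimately show ?case
    unfolding suc using IH(3) mod(3)
    by - (rule exI[of _ g], rule exI[of _ f'], rule exI[of _ g'], (elim conjE, intro conjI))
qed

lemma newton3_6_18_36_nonzero:
  assumes "3 < n"
  shows "newton3 6 18 36 n \<noteq> (0 :: int)"
proof -
  have "\<exists>m. n = 2 * (m + 2) \<or> n = 2 * (m + 2) + 1" using assms by presburger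
  then obtain m where n: "n = 2 * (m + 2) \<or> n = 2 * (m + 2) + 1" ..
  obtain e f where L: "newton3 6 18 36 (2 * (m + 2)) = (2 ^ (m + 2) * e :: int)"
    "newton3 6 18 36 (2 * (m + 2) + 1) = (2 ^ (m + 2) * f :: int)"
    and "e mod 4 = 2" "f mod 8 = 4"
    using newton3_6_18_36_even_odd[of m] by blast
  then have "e \<noteq> 0" "f \<noteq> 0" by auto
  then show ?thesis using n L by (metis mult_eq_0_iff power_eq_0_iff zero_neq_numeral)
qed

section \<open>Common zeros on the plane of vanishing sum\<close>

text \<open>\<open>r\<close>, \<open>s\<close>, \<open>t\<close> are the roots of
  \<open>x ^ 3 = r * s * t\<close>, so for \<open>n = 3 * k\<close> the power sum is
  \<open>3 * (r * s * t) ^ k\<close>.\<close>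

lemma common_zero_trivial_if_3_dvd:
  fixes r s t :: complex
  assumes "r + s + t = 0" "r * s + s * t + t * r = 0" "3 dvd n" "0 < n" "r ^ n + s ^ n + t ^ n = 0"
  shows "r = 0 \<and> s = 0"
proof -
  obtain k where n: "n = 3 * k" using assms(3) ..
  have "x ^ 3 = r * s * t" if "(x - r) * (x - s) * (x - t) = 0" for x
  proof -
    have "(x - r) * (x - s) * (x - t)
      = x ^ 3 - (r + s + t) * x ^ 2 + (r * s + s * t + t * r) * x - r * s * t"
      by (simp add: algebra_simps power2_eq_square power3_eq_cube)
    then show ?thesis using that assms(1,2) by simp
  qed
  then have cubes: "r ^ 3 = r * s * t" "s ^ 3 = r * s * t" "t ^ 3 = r * s * t" by simp_all
  then have "3 * (r * s * t) ^ k = 0"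
    using assms(5) unfolding n power_mult by simp
  then have zero: "r * s * t = 0" by simp
  have "r ^ 3 = 0" "s ^ 3 = 0" using cubes(1,2) unfolding zero .
  then show ?thesis by simp
qed

text \<open>One coordinate is 0 and the other two are opposite, so an even power sum is twice a
  single power.\<close>

lemma common_zero_trivial_if_even:
  fixes r s t :: complex
  assumes "r + s + t = 0" "r * s * t = 0" "even n" "0 < n" "r ^ n + s ^ n + t ^ n = 0"
  shows "r = 0 \<and> s = 0"
proof -
  consider "r = 0" "t = - s" | "s = 0" "t = - r" | "t = 0" "s = - r"
    using assms(1,2) by (auto simp: add_eq_0_iff)
  then show ?thesis using assms(3-5) by cases (auto simp: power_0_left)
qed

lemma common_zero_trivial_if_6:
  fixes r s t :: complex
  assumes "r + s + t = 0" "r ^ 6 + s ^ 6 + t ^ 6 = 0"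
    and "1 < n" "n \<noteq> 6" "r ^ n + s ^ n + t ^ n = 0"
  shows "r = 0 \<and> s = 0"
proof -
  define e2 where "e2 = r * s + s * t + t * r"
  define e3 where "e3 = r * s * t"
  have power_sum: "r ^ k + s ^ k + t ^ k = newton3 0 e2 e3 k" for k
    using newton3_power_sum[of r k s t] by (simp add: assms(1) e2_def e3_def)
  have e: "3 * e3 ^ 2 = 2 * e2 ^ 3"
    using assms(2) unfolding power_sum
    by (simp add: eval_nat_numeral algebra_simps)
  have "e2 = 0"
  proof (rule ccontr)
    assume "e2 \<noteq> 0"
    \<comment> \<open>The pair 6, 12 is an integral solution of the relation \<open>e\<close>.
      Matching \<open>e2 = 6 * \<theta> ^ 2\<close> and \<open>e3 = 12 * \<theta> ^ 3\<close> forces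
      this quotient.\<close>
    define \<theta> where "\<theta> = e3 / (2 * e2)"
    have e2: "e2 = \<theta> ^ 2 * 6"
      using \<open>e2 \<noteq> 0\<close> e by (simp add: \<theta>_def field_simps power2_eq_square power3_eq_cube)
    have "e3 = 2 * e2 * \<theta>" using \<open>e2 \<noteq> 0\<close> by (simp add: \<theta>_def)
    then have e3: "e3 = \<theta> ^ 3 * 12" using e2 by (simp add: power2_eq_square power3_eq_cube)
    have "newton3 0 e2 e3 n = \<theta> ^ n * of_int (newton3 0 6 12 n)"
      using newton3_scale[of \<theta> 0 6 12 n] by (simp add: e2 e3 of_int_newton3)
    moreover have "\<theta> \<noteq> 0" using e2 \<open>e2 \<noteq> 0\<close> by auto
    ultimately show False
      using assms(5) newton3_0_6_12_nonzero[OF assms(3,4)] unfolding power_sum by simp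
  qed
  then show ?thesis
    using common_zero_trivial_if_3_dvd[of r s t 6] assms(1,2) by (simp add: e2_def)
qed

text \<open>For \<open>m \<noteq> 6\<close> the vanishing monomial gives \<open>e2 = 0\<close> or
  \<open>e3 = 0\<close>, and \<open>6 dvd m * n\<close> gives \<open>n\<close> the divisibility by 3
  or 2 that the respective case requires.\<close>

lemma common_zero_trivial_one:
  fixes r s t :: complex
  assumes m: "2 \<le> m" "m \<le> 7" and n: "1 < n" "n \<noteq> m" and "6 dvd m * n"
    and sum: "r + s + t = 0" and "r ^ m + s ^ m + t ^ m = 0" and pn: "r ^ n + s ^ n + t ^ n = 0"
  shows "r = 0 \<and> s = 0"
proof -
  define e2 where "e2 = r * s + s * t + t * r"
  define e3 where "e3 = r * s * t"
  have pm: "newton3 0 e2 e3 m = 0"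
    using newton3_power_sum[of r m s t] assms(7) by (simp add: sum e2_def e3_def)
  have e2: ?thesis if "e2 = 0" "3 dvd n"
    using sum _ that(2) _ pn
    by (rule common_zero_trivial_if_3_dvd) (use that(1) n in \<open>simp_all add: e2_def\<close>)
  have e3: ?thesis if "e3 = 0" "even n"
    using sum _ that(2) _ pn
    by (rule common_zero_trivial_if_even) (use that(1) n in \<open>simp_all add: e3_def\<close>)
  consider "m = 2" | "m = 3" | "m = 4" | "m = 5" | "m = 6" | "m = 7" using m by linarith
  then show ?thesis
  proof cases
    case 1
    then have "3 dvd n" using assms(5) by presburger
    moreover have "e2 = 0" using pm 1 by (simp add: eval_nat_numeral)
    ultimately show ?thesis using e2 by blast
  next
    case 2
    then have "even n" using assms(5) by presburger
    moreover have "e3 = 0" using pm 2 by (simp add: eval_nat_numeral)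
    ultimately show ?thesis using e3 by blast
  next
    case 3
    then have "3 dvd n" using assms(5) by presburger
    moreover have "e2 = 0" using pm 3 by (simp add: eval_nat_numeral)
    ultimately show ?thesis using e2 by blast
  next
    case 4
    then have "3 dvd n" "even n" using assms(5) by presburger+
    moreover have "newton3 0 e2 e3 5 = -5 * (e2 * e3)"
      by (simp add: eval_nat_numeral algebra_simps)
    then have "e2 = 0 \<or> e3 = 0" using pm 4 by auto
    ultimately show ?thesis using e2 e3 by blast
  next
    case 5
    then show ?thesis using common_zero_trivial_if_6[of r s t n] assms by simp
  next
    case 6
    then have "3 dvd n" "even n" using assms(5) by presburger+
    moreover have "newton3 0 e2 e3 7 = 7 * (e2 ^ 2 * e3)"
      by (simp add: eval_nat_numeral algebra_simps)
    then have "e2 = 0 \<or> e3 = 0" using pm 6 by auto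
    ultimately show ?thesis using e2 e3 by blast
  qed
qed

lemma regular_sequence_1:
  assumes "1 < b" "1 < c" "b \<noteq> c" "6 dvd b * c" and "(2 \<le> b \<and> b \<le> 7) \<or> (2 \<le> c \<and> c \<le> 7)"
  shows "regular_sequence [power_sum3 1, power_sum3 b, power_sum3 c]"
proof (rule regular_sequence_1_if_no_common_zero)
  fix r s t :: complex
  assume "r + s + t = 0" "r ^ b + s ^ b + t ^ b = 0" "r ^ c + s ^ c + t ^ c = 0"
  moreover have "6 dvd c * b" using assms(4) by (simp add: mult.commute)
  ultimately show "r = 0 \<and> s = 0"
    using assms common_zero_trivial_one[of b c r s t] common_zero_trivial_one[of c b r s t] by blast
qed (use assms in auto)

section \<open>Sequences containing the degrees 2 and 3\<close>

text \<open>A common divisor divides a nonzero polynomial free of \<open>x3\<close>, so it is itself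
  free of \<open>x3\<close>; then it divides the leading coefficient 1 of
  \<open>power_sum3 2\<close>.\<close>

lemma coprime_power_sum3_2_3: "coprime (power_sum3 2) (power_sum3 3)"
proof (rule coprimeI)
  fix h assume h2: "h dvd power_sum3 2" and h3: "h dvd power_sum3 3"
  define X Y :: "complex poly poly" where "X = [:[:0, 1:]:]" and "Y = [:0, 1:]"
  have p2: "power_sum3 2 = [:X ^ 2 + Y ^ 2, 0, 1:]"
    and p3: "power_sum3 3 = [:X ^ 3 + Y ^ 3, 0, 0, 1:]"
    by (simp_all add: power_sum3_def x1_def x2_def x3_def X_def Y_def eval_nat_numeral)
  \<comment> \<open>the norm of \<open>p\<^sub>3\<close> with respect to the extension given by the quadratic \<open>p\<^sub>2\<close>\<close>
  let ?N = "(X ^ 3 + Y ^ 3) ^ 2 + (X ^ 2 + Y ^ 2) ^ 3"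
  \<comment> \<open>With \<open>A = X ^ 3 + Y ^ 3\<close> and \<open>B = X ^ 2 + Y ^ 2\<close>,
    reducing \<open>power_sum3 3\<close> by \<open>power_sum3 2\<close> leaves
    \<open>A - B * x3\<close>. Multiply by the conjugate \<open>A + B * x3\<close> and replace
    \<open>x3 ^ 2\<close> by \<open>- B\<close>.\<close>
  have "[:?N:] = [:X ^ 3 + Y ^ 3, X ^ 2 + Y ^ 2:] * power_sum3 3
      - [:X ^ 3 + Y ^ 3, X ^ 2 + Y ^ 2:] * [:0, 1:] * power_sum3 2
      + [:(X ^ 2 + Y ^ 2) ^ 2:] * power_sum3 2"
    by (simp add: p2 p3 algebra_simps power2_eq_square power3_eq_cube)
  then have "h dvd [:?N:]"
    using h2 h3 by (metis dvd_add dvd_diff dvd_mult)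
  moreover have "?N \<noteq> 0"
  proof
    assume "?N = 0"
    then have "poly (poly ?N 0) 1 = 0" by simp
    then show False by (simp add: X_def Y_def)
  qed
  then have "[:?N:] \<noteq> 0" by (metis pCons_eq_0_iff)
  ultimately have "degree h \<le> degree [:?N:]" by (rule dvd_imp_degree_le)
  then obtain h0 where h0: "h = [:h0:]" by (metis degree_eq_zeroE degree_pCons_0 le_zero_eq)
  then have "h0 dvd coeff (power_sum3 2) 2"
    using h2 const_poly_dvd_iff by blast
  then have "h0 dvd 1" unfolding p2 by (simp add: eval_nat_numeral)
  then show "is_unit h" by (simp add: h0 is_unit_const_poly_iff)
qed

lemma regular_sequence_2_3_1: "regular_sequence [power_sum3 2, power_sum3 3, power_sum3 1]"
proof (rule regular_sequence_rotate)
  show "regular_sequence [power_sum3 1, power_sum3 2, power_sum3 3]"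
    by (rule regular_sequence_1) auto
  have "coeff (power_sum3 2) 2 \<noteq> 0"
    by (simp add: power_sum3_def x1_def x2_def x3_def eval_nat_numeral)
  then show "power_sum3 2 \<noteq> 0" by auto
  show "power_sum3 2 dvd u" if "power_sum3 2 dvd power_sum3 3 * u" for u
    using that coprime_power_sum3_2_3 by (simp add: coprime_dvd_mult_right_iff)
qed

text \<open>Modulo \<open>p\<^sub>2\<close> and \<open>p\<^sub>3\<close> one has \<open>e2 = e1\<^sup>2 / 2\<close> and \<open>e3 = e1\<^sup>3 / 6\<close>; scaling the
  variables by 6 makes the coefficients 6, 18, 36.\<close>

lemma power_sum3_mod_2_3:
  obtains v w where "6 ^ n * power_sum3 n =
    power_sum3 1 ^ n * of_int (newton3 6 18 36 n) + v * power_sum3 2 + w * power_sum3 3"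
proof -
  define I where "I = {v * power_sum3 2 + w * power_sum3 3 | v w. True}"
  have IE: "\<exists>v w. x = v * power_sum3 2 + w * power_sum3 3" if "x \<in> I" for x
    using that by (auto simp: I_def)
  have II: "v * power_sum3 2 + w * power_sum3 3 \<in> I" for v w
    by (auto simp: I_def)
  have add: "x + y \<in> I" if x: "x \<in> I" and y: "y \<in> I" for x y
  proof -
    obtain v w v' w' where "x = v * power_sum3 2 + w * power_sum3 3"
      "y = v' * power_sum3 2 + w' * power_sum3 3" using IE[OF x] IE[OF y] by blast
    then have "x + y = (v + v') * power_sum3 2 + (w + w') * power_sum3 3"
      by (simp add: algebra_simps)
    then show ?thesis using II by metis
  qed
  have scale: "u * x \<in> I" if x: "x \<in> I" for x u
  proof -
    obtain v w where "x = v * power_sum3 2 + w * power_sum3 3" using IE[OF x] by blast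
    then have "u * x = (u * v) * power_sum3 2 + (u * w) * power_sum3 3"
      by (simp add: algebra_simps)
    then show ?thesis using II by metis
  qed
  define e1 where "e1 = x1 + x2 + x3"
  define e2 where "e2 = x1 * x2 + x2 * x3 + x3 * x1"
  define e3 where "e3 = x1 * x2 * x3"
  have p1: "power_sum3 1 = e1" by (simp add: power_sum3_def e1_def)
  \<comment> \<open>This and the next identity are Newton's \<open>2 * e2 = e1 ^ 2 - p2\<close> and
    \<open>6 * e3 = e1 ^ 3 - 3 * e1 * p2 + 2 * p3\<close>, multiplied by 18 and 36.\<close>
  have "6 ^ 2 * e2 - e1 ^ 2 * 18 = (- 18) * power_sum3 2 + 0 * power_sum3 3"
    by (simp add: e1_def e2_def power_sum3_def power2_eq_square algebra_simps)
  then have b: "6 ^ 2 * e2 - e1 ^ 2 * 18 \<in> I" using II by metis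
  have "6 ^ 3 * e3 - e1 ^ 3 * 36 = (- 108 * e1) * power_sum3 2 + 72 * power_sum3 3"
    by (simp add: e1_def e3_def power_sum3_def power2_eq_square power3_eq_cube algebra_simps)
  then have c: "6 ^ 3 * e3 - e1 ^ 3 * 36 \<in> I" using II by metis
  have "power_sum3 n = newton3 e1 e2 e3 n"
    unfolding power_sum3_def e1_def e2_def e3_def by (rule newton3_power_sum)
  \<comment> \<open>\<open>newton3_scale\<close> serves twice: with factor 6 on
    \<open>(e1, e2, e3)\<close>, then with factor \<open>e1\<close> on
    \<open>(6, 18, 36)\<close>.\<close>
  then have "6 ^ n * power_sum3 n = newton3 (e1 * 6) (6 ^ 2 * e2) (6 ^ 3 * e3) n"
    by (simp only: newton3_scale mult.commute[of e1])
  moreover have "newton3 (e1 * 6) (e1 ^ 2 * 18) (e1 ^ 3 * 36) n = e1 ^ n * of_int (newton3 6 18 36 n)"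
    by (simp only: newton3_scale of_int_newton3 of_int_numeral)
  moreover have "newton3 (e1 * 6) (6 ^ 2 * e2) (6 ^ 3 * e3) n
      - newton3 (e1 * 6) (e1 ^ 2 * 18) (e1 ^ 3 * 36) n \<in> I"
    using add scale b c by (rule newton3_cong)
  ultimately have "6 ^ n * power_sum3 n - e1 ^ n * of_int (newton3 6 18 36 n) \<in> I"
    by (simp only:)
  from IE[OF this] obtain v w where "6 ^ n * power_sum3 n - e1 ^ n * of_int (newton3 6 18 36 n)
    = v * power_sum3 2 + w * power_sum3 3" by blast
  then have "6 ^ n * power_sum3 n = e1 ^ n * of_int (newton3 6 18 36 n)
      + v * power_sum3 2 + w * power_sum3 3"
    by (simp only: diff_eq_eq ac_simps)
  then show ?thesis using that unfolding p1 by blast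
qed

text \<open>Modulo the first two power sums, \<open>6 ^ n * power_sum3 n\<close> is
  \<open>N * power_sum3 1 ^ n\<close> with a nonzero integer \<open>N\<close>, a unit over the
  complex numbers. The factors \<open>power_sum3 1\<close> then cancel one at a time.\<close>

lemma regular_sequence_2_3:
  assumes "3 < n"
  shows "regular_sequence [power_sum3 2, power_sum3 3, power_sum3 n]"
proof -
  let ?p = "power_sum3 2" and ?q = "power_sum3 3" and ?e = "power_sum3 1"
  from regular_sequence_2_3_1 have p: "?p * u = 0 \<Longrightarrow> u = 0" and q: "?p dvd ?q * u \<Longrightarrow> ?p dvd u"
    and e: "?e * u = v * ?p + w * ?q \<Longrightarrow> \<exists>v w. u = v * ?p + w * ?q" for u v w
    unfolding regular_sequence_triple_iff by blast+
  have e_pow: "\<exists>v w. u = v * ?p + w * ?q" if "?e ^ k * u = v * ?p + w * ?q" for k u v w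
    using that
  proof (induction k arbitrary: v w)
    case 0
    then show ?case by auto
  next
    case (Suc k)
    then have "?e * (?e ^ k * u) = v * ?p + w * ?q" by (simp only: power_Suc mult.assoc)
    then obtain v' w' where "?e ^ k * u = v' * ?p + w' * ?q" using e by blast
    then show ?case by (rule Suc.IH)
  qed
  define N :: int where "N = newton3 6 18 36 n"
  have "N \<noteq> 0" unfolding N_def using assms by (rule newton3_6_18_36_nonzero)
  define c :: R3 where "c = [:[:[:1 / of_int N:]:]:]"
  have c: "c * of_int N = 1"
    using \<open>N \<noteq> 0\<close> by (simp add: c_def of_int_poly one_pCons)
  obtain a b where pn: "6 ^ n * power_sum3 n = ?e ^ n * of_int N + a * ?p + b * ?q"
    unfolding N_def by (rule power_sum3_mod_2_3)
  have "\<exists>v w. u = v * ?p + w * ?q" if eq: "power_sum3 n * u = v * ?p + w * ?q" for u v w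
  proof -
    have "?e ^ n * u = ?e ^ n * u * (c * of_int N)" by (simp add: c)
    also have "\<dots> = c * u * (?e ^ n * of_int N)" by (simp only: ac_simps)
    also have "\<dots> = c * (6 ^ n * (power_sum3 n * u) - u * (a * ?p + b * ?q))"
      using arg_cong[OF pn, of "\<lambda>x. c * u * x"] by (simp add: algebra_simps)
    also have "\<dots> = (c * (6 ^ n * v - u * a)) * ?p + (c * (6 ^ n * w - u * b)) * ?q"
      unfolding eq by (simp add: algebra_simps)
    finally show ?thesis by (rule e_pow)
  qed
  moreover have "u * ?p + v * ?q + w * power_sum3 n \<noteq> 1" for u v w
    by (rule power_sum3_ideal_proper) (use assms in auto)
  ultimately show ?thesis
    unfolding regular_sequence_triple_iff using p q by blast
qed

theorem theorem2p11:
  fixes a b c :: nat and A :: "nat set"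
  assumes "A = {a, b, c}"
    and "0 < a" and "a < b" and "b < c"
    and "gcd a (gcd b c) = 1"
    and "(1 \<in> A \<and> (\<exists>m\<in>A. 2 \<le> m \<and> m \<le> 7)) \<or> (2 \<in> A \<and> 3 \<in> A)"
  shows "regular_sequence [power_sum3 a, power_sum3 b, power_sum3 c] \<longleftrightarrow> [a * b * c = 0] (mod 6)"
proof
  assume "regular_sequence [power_sum3 a, power_sum3 b, power_sum3 c]"
  then have "6 dvd a * b * c"
    using not_regular_sequence_if_not_dvd_6[of a b c] assms(2-4) by fastforce
  then show "[a * b * c = 0] (mod 6)" by (simp add: cong_0_iff)
next
  assume "[a * b * c = 0] (mod 6)"
  then have 6: "6 dvd a * b * c" by (simp add: cong_0_iff)
  \<comment> \<open>By the ordering, \<open>1 \<in> A\<close> forces \<open>a = 1\<close>. If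
    \<open>A\<close> contains 2 and 3, then \<open>a = 2\<close> and \<open>b = 3\<close>, or
    \<open>a = 1\<close> and \<open>b = 2\<close>, which falls under the first alternative.\<close>
  have "(a = 1 \<and> (2 \<le> b \<and> b \<le> 7 \<or> 2 \<le> c \<and> c \<le> 7)) \<or> (a = 2 \<and> b = 3)"
    using assms(1-4,6) by auto
  then show "regular_sequence [power_sum3 a, power_sum3 b, power_sum3 c]"
  proof (elim disjE[of "_ \<and> (_ \<or> _)"])
    assume "a = 1 \<and> (2 \<le> b \<and> b \<le> 7 \<or> 2 \<le> c \<and> c \<le> 7)"
    then show ?thesis using regular_sequence_1[of b c] assms(3,4) 6 by simp
  next
    assume "a = 2 \<and> b = 3"
    then show ?thesis using regular_sequence_2_3[of c] assms(4) by blast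
  qed
qed

end
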